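(* Let $m\to\infty$, and let $n=n_m\to\infty$, $s=s_m$ and the distribution $\overline P$ of the random vector $\overline X=(X_1,\dots,X_n)$ depend on $m$. Consider the sequence of random intersection graphs $\overline G_s(n,m,\overline P)$ and let $\overline d_m(v_1)$ denote the degree of $v_1$ in $\overline G_s(n,m,\overline P)$. Assume that, as $m\to\infty$: (iv) $\lambda(\overline X)$ converges in distribution to a random variable $\Lambda$; (v) $\kappa_1(\overline X)\to0$ in probability; (vi) $\kappa_2(\overline X)\to 0$ in probability. Then for every $k=0,1,2,\dots$ $$\lim_{m\to\infty}\mathbf P\bigl(\overline d_m(v_1)=k\bigr)=\frac{1}{k!}\,\mathbf E\bigl(\Lambda^k e^{-\Lambda}\bigr).$$
   Context: Let $W=\{w_1,\dots,w_m\}$ and let $s\ge 1$ be an integer. Let $D_1,\dots,D_n$ be independent (not necessarily identically distributed) random subsets of $W$, write $X_k=|D_k|$, and assume that for every $k=1,\dots,n$ and each $A\subset W$, $\mathbf P(D_k=A)=\binom{m}{|A|}^{-1}\mathbf P(X_k=|A|)$. Let $\overline P$ be the distribution of the random vector $\overline X=(X_1,\dots,X_n)$. The graph $\overline G_s(n,m,\overline P)$ has vertex set $V=\{v_1,\dots,v_n\}$, and distinct vertices $v_i,v_j$ are adjacent whenever $|D_i\cap D_j|\ge s$. For a vector $\overline x=(x_1,\dots,x_n)$ with nonnegative integer coordinates put $u_k=\binom{x_1}{s}\binom{x_k}{s}$, $x_k^+=\max\{0,x_k-s\}$, and $$\lambda(\overline x)=\binom ms^{-1}\sum_{k=2}^n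 u_k,\qquad \kappa_1(\overline x)=\binom ms^{-2}\sum_{k=2}^n u_k^2,\qquad \kappa_2(\overline x)=\frac{x_1^+}{m-x_1}\binom ms^{-1}\sum_{k=2}^n u_k x_k^+.$$ *)

theory Defs
  imports "HOL-Probability.Probability" "Graph_Theory.Pair_Digraph"
begin

text \<open>
  The family is indexed by \<open>1, \<dots>, n\<close>. Given its size, each \<open>D k\<close> is uniform among the subsets of
  \<open>W\<close> of that size; the laws of the sizes \<open>card (D k)\<close> are arbitrary and may depend on \<open>k\<close>.
\<close>

locale uniform_random_subsets = prob_space M
  for M :: "'a measure" +
  fixes W :: "'w set" and n :: nat and D :: "nat \<Rightarrow> 'a \<Rightarrow> 'w set"
  assumes finite_W: "finite W"
    and indep_D: "indep_vars (\<lambda>_. count_space (Pow W)) D {1..n}"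
    and prob_D: "\<And>k A. k \<in> {1..n} \<Longrightarrow> A \<subseteq> W \<Longrightarrow>
      prob {\<omega> \<in> space M. D k \<omega> = A}
        = prob {\<omega> \<in> space M. card (D k \<omega>) = card A} / real (card W choose card A)"

text \<open>Simple graphs are symmetric loop-free digraphs; vertex \<open>v\<^sub>i\<close> is the number \<open>i\<close>.\<close>

definition intersection_graph :: "nat \<Rightarrow> nat \<Rightarrow> (nat \<Rightarrow> 'w set) \<Rightarrow> nat pair_pre_digraph" where
  "intersection_graph s n S =
     \<lparr>pverts = {1..n},
      parcs = {(i, j). i \<in> {1..n} \<and> j \<in> {1..n} \<and> i \<noteq> j \<and> s \<le> card (S i \<inter> S j)}\<rparr>"

lemma pair_graph_intersection_graph: "pair_graph (intersection_graph s n S)"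
proof
  have "parcs (intersection_graph s n S) \<subseteq> {1..n} \<times> {1..n}"
    by (auto simp: intersection_graph_def)
  then show "finite (parcs (intersection_graph s n S))"
    by (rule finite_subset) simp
  show "symmetric (with_proj (intersection_graph s n S))"
    by (auto simp: intersection_graph_def symmetric_def sym_def arcs_ends_conv Int_commute)
qed (auto simp: intersection_graph_def)

definition graph_degree :: "'v pair_pre_digraph \<Rightarrow> 'v \<Rightarrow> nat" where
  "graph_degree G v = out_degree (with_proj G) v"

definition u_weight :: "nat \<Rightarrow> (nat \<Rightarrow> nat) \<Rightarrow> nat \<Rightarrow> real" where
  "u_weight s x k = real (x 1 choose s) * real (x k choose s)"

definition excess :: "nat \<Rightarrow> nat \<Rightarrow> real" where
  "excess s y = max 0 (real y - real s)"

definition lambda_stat :: "nat \<Rightarrow> nat \<Rightarrow> nat \<Rightarrow> (nat \<Rightarrow> nat) \<Rightarrow> real" where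
  "lambda_stat m s n x = inverse (real (m choose s)) * (\<Sum>k=2..n. u_weight s x k)"

definition kappa1 :: "nat \<Rightarrow> nat \<Rightarrow> nat \<Rightarrow> (nat \<Rightarrow> nat) \<Rightarrow> real" where
  "kappa1 m s n x = (inverse (real (m choose s)))\<^sup>2 * (\<Sum>k=2..n. (u_weight s x k)\<^sup>2)"

text \<open>
  For \<open>x 1 = m\<close> the denominator vanishes and the value below is \<open>0\<close>. This choice is immaterial
  when \<open>kappa1\<close> tends to \<open>0\<close> in probability: if \<open>x 1 = m\<close> and \<open>s \<le> m\<close> then \<open>kappa1\<close> is the integer
  \<open>\<Sum>k=2..n. (x k choose s)\<^sup>2\<close>, so with probability tending to one either \<open>x 1 < m\<close> or every term
  \<open>u_weight s x k\<close> is \<open>0\<close>.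
\<close>

definition kappa2 :: "nat \<Rightarrow> nat \<Rightarrow> nat \<Rightarrow> (nat \<Rightarrow> nat) \<Rightarrow> real" where
  "kappa2 m s n x = excess s (x 1) / (real m - real (x 1)) * inverse (real (m choose s))
     * (\<Sum>k=2..n. u_weight s x k * excess s (x k))"

text \<open>The random variables may live on different probability spaces.\<close>

definition tendsto_in_probability ::
    "(nat \<Rightarrow> 'a measure) \<Rightarrow> (nat \<Rightarrow> 'a \<Rightarrow> real) \<Rightarrow> real \<Rightarrow> bool" where
  "tendsto_in_probability M Y c \<longleftrightarrow>
     (\<forall>\<epsilon>>0. (\<lambda>m. measure (M m) {\<omega> \<in> space (M m). \<bar>Y m \<omega> - c\<bar> > \<epsilon>}) \<longlonglongrightarrow> 0)"

definition tendsto_in_distribution ::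
    "(nat \<Rightarrow> 'a measure) \<Rightarrow> (nat \<Rightarrow> 'a \<Rightarrow> real) \<Rightarrow> 'b measure \<Rightarrow> ('b \<Rightarrow> real) \<Rightarrow> bool" where
  "tendsto_in_distribution M Y N Z \<longleftrightarrow>
     weak_conv_m (\<lambda>m. distr (M m) borel (Y m)) (distr N borel Z)"

end

theory Submission
  imports Defs
begin

text \<open>
  Given \<open>D 1\<close> and the sizes of all sets, the degree of \<open>v\<^sub>1\<close> is a sum of independent indicators whose
  means \<open>p\<^sub>i\<close> are hypergeometric tails. Double counting subsets with \<open>s\<close> and \<open>s + 1\<close> elements bounds
  \<open>p\<^sub>i\<close> by \<open>u\<^sub>i / (m choose s)\<close> from above, with total defect at most \<open>kappa2\<close> once \<open>kappa1 < 1\<close>, so Le Cam's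
  inequality puts the conditional law within \<open>2 * kappa1 + kappa2\<close> of the Poisson law with mean
  \<open>lambda_stat\<close>. The Poisson mass at \<open>k\<close> is a bounded continuous function of the mean, hence
  convergence in distribution of \<open>lambda_stat\<close> passes to the limit.
\<close>

section \<open>The Poisson mass at a fixed point as a function of the mean\<close>

definition pois :: "nat \<Rightarrow> real \<Rightarrow> real" where
  "pois k t = t ^ k / fact k * exp (- t)"

text \<open>Truncated subtraction would make \<open>pois (k - 1)\<close> wrong at
  \<open>k = 0\<close>. With the value 0 there, the formula for the derivative of
  \<open>pois k\<close> is uniform in \<open>k\<close>.\<close>

definition pois_prev :: "nat \<Rightarrow> real \<Rightarrow> real" where
  "pois_prev k t = (case k of 0 \<Rightarrow> 0 | Suc j \<Rightarrow> pois j t)"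

lemma pois_nonneg: "0 \<le> t \<Longrightarrow> 0 \<le> pois k t"
  by (simp add: pois_def)

lemma pois_le_1:
  assumes "0 \<le> t"
  shows "pois k t \<le> 1"
proof (cases "t = 0")
  case True
  then show ?thesis by (cases k) (simp_all add: pois_def)
next
  case False
  with assms have "0 < t" by simp
  then show ?thesis
    unfolding pois_def pmf_poisson[OF \<open>0 < t\<close>, symmetric] by (intro pmf_le_1)
qed

lemma pois_prev_nonneg: "0 \<le> t \<Longrightarrow> 0 \<le> pois_prev k t"
  and pois_prev_le_1: "0 \<le> t \<Longrightarrow> pois_prev k t \<le> 1"
  by (auto simp: pois_prev_def pois_nonneg pois_le_1 split: nat.split)

lemma DERIV_pois: "DERIV (pois k) t :> pois_prev k t - pois k t"
proof (cases k)
  case 0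
  then show ?thesis
    unfolding pois_def [abs_def] pois_prev_def by (auto intro!: derivative_eq_intros)
next
  case (Suc j)
  have "real (Suc j) * t ^ j / fact (Suc j) = t ^ j / fact j"
    by (simp add: divide_simps del: of_nat_Suc)
  then have eq: "real (Suc j) * t ^ j / fact (Suc j) * exp (- t) + t ^ Suc j / fact (Suc j) * (exp (- t) * - 1)
      = pois_prev k t - pois k t"
    unfolding Suc pois_def pois_prev_def by (simp del: fact_Suc power_Suc)
  show ?thesis
    unfolding eq[symmetric] unfolding Suc pois_def [abs_def]
    by (rule derivative_eq_intros refl | simp del: fact_Suc of_nat_Suc power_Suc)+
qed

lemma isCont_pois: "isCont (pois k) t"
  using DERIV_pois by (rule DERIV_isCont)

text \<open>On the nonnegative axis the derivative is a difference of two numbers in [0, 1], so the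
  mean value theorem gives the Lipschitz constant 1.\<close>

lemma pois_lipschitz:
  assumes "0 \<le> a" "0 \<le> b"
  shows "\<bar>pois k a - pois k b\<bar> \<le> \<bar>a - b\<bar>"
proof -
  have *: "\<bar>pois k b - pois k a\<bar> \<le> b - a" if "0 \<le> a" "a < b" for a b
  proof -
    obtain z where z: "a < z" "z < b" "pois k b - pois k a = (b - a) * (pois_prev k z - pois k z)"
      using MVT2[OF \<open>a < b\<close>, of "pois k" "\<lambda>z. pois_prev k z - pois k z"] DERIV_pois by blast
    have "\<bar>pois_prev k z - pois k z\<bar> \<le> 1"
      using that z pois_nonneg[of z k] pois_le_1[of z k] pois_prev_nonneg[of z k]
        pois_prev_le_1[of z k] by linarith
    then have "(b - a) * \<bar>pois_prev k z - pois k z\<bar> \<le> (b - a) * 1"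
      using that by (intro mult_left_mono) auto
    then show ?thesis
      unfolding z(3) abs_mult using that by simp
  qed
  show ?thesis
    using *[of a b] *[of b a] assms by (cases a b rule: linorder_cases) auto
qed

lemma pois_prev_lipschitz:
  assumes "0 \<le> a" "0 \<le> b"
  shows "\<bar>pois_prev k a - pois_prev k b\<bar> \<le> \<bar>a - b\<bar>"
  using assms pois_lipschitz by (auto simp: pois_prev_def split: nat.split)

text \<open>This compares adding \<open>p\<close> to a Poisson mean with adding an independent
  indicator of mean \<open>p\<close>. The mixture is the first-order Taylor expansion of
  \<open>pois k\<close> at \<open>t\<close>; the derivative is a difference of two functions with
  Lipschitz constant 1, which bounds the error by \<open>2 * p\<^sup>2\<close>.\<close>

lemma pois_step:
  assumes "0 \<le> t" "0 \<le> p"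
  shows "\<bar>pois k (t + p) - ((1 - p) * pois k t + p * pois_prev k t)\<bar> \<le> 2 * p\<^sup>2"
proof (cases "p = 0")
  case False
  define d where "d z = pois_prev k z - pois k z" for z
  obtain z where z: "t < z" "z < t + p" "pois k (t + p) - pois k t = p * d z"
    using MVT2[of t "t + p" "pois k" d] DERIV_pois False assms unfolding d_def by auto
  have "\<bar>d z - d t\<bar> \<le> 2 * p"
    using pois_lipschitz[of z t k] pois_prev_lipschitz[of z t k] z assms unfolding d_def by linarith
  then have "p * \<bar>d z - d t\<bar> \<le> p * (2 * p)"
    using assms by (intro mult_left_mono) auto
  moreover have "pois k (t + p) - ((1 - p) * pois k t + p * pois_prev k t) = p * (d z - d t)"
    using z(3) by (simp add: d_def algebra_simps)
  ultimately show ?thesis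
    using assms by (simp add: abs_mult power2_eq_square)
qed simp

section \<open>Sums of independent indicators and Le Cam's inequality\<close>

text \<open>The law of a sum of independent indicators with means \<open>p i\<close>, where
  \<open>J\<close> is the set of successes. Being an explicit polynomial, affine in each
  \<open>p i\<close>, it can later be averaged factor by factor when the entries are random.\<close>

definition poisson_binomial :: "'i set \<Rightarrow> ('i \<Rightarrow> real) \<Rightarrow> nat \<Rightarrow> real" where
  "poisson_binomial I p k = (\<Sum>J | J \<subseteq> I \<and> card J = k. (\<Prod>i\<in>J. p i) * (\<Prod>i\<in>I - J. 1 - p i))"

lemma poisson_binomial_empty: "poisson_binomial {} p k = (if k = 0 then 1 else 0)"
proof -
  have *: "{J. J \<subseteq> {} \<and> card J = k} = (if k = 0 then {{}} else {})" by auto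
  show ?thesis unfolding poisson_binomial_def * by simp
qed

text \<open>Condition on the trial \<open>a\<close>: a failure leaves \<open>k\<close> successes to
  \<open>I\<close>, a success leaves \<open>k - 1\<close>, which is impossible for
  \<open>k = 0\<close>.\<close>

lemma poisson_binomial_insert:
  assumes "finite I" "a \<notin> I"
  shows "poisson_binomial (insert a I) p k =
    (1 - p a) * poisson_binomial I p k
      + p a * (case k of 0 \<Rightarrow> 0 | Suc j \<Rightarrow> poisson_binomial I p j)"
proof -
  let ?g = "\<lambda>J. (\<Prod>i\<in>J. p i) * (\<Prod>i\<in>insert a I - J. 1 - p i)"
  let ?B = "{J. J \<subseteq> I \<and> Suc (card J) = k}"
  have split: "{J. J \<subseteq> insert a I \<and> card J = k} = {J. J \<subseteq> I \<and> card J = k} \<union> insert a ` ?B" (is "?L = ?R")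
  proof
    show "?L \<subseteq> ?R"
    proof
      fix J assume "J \<in> ?L"
      then have J: "J \<subseteq> insert a I" "card J = k" "finite J"
        using assms finite_subset by auto
      show "J \<in> ?R"
      proof (cases "a \<in> J")
        case True
        then have "J = insert a (J - {a})" "J - {a} \<in> ?B"
          using J card_Suc_Diff1[of J a] by auto
        then show ?thesis by blast
      qed (use J in auto)
    qed
    show "?R \<subseteq> ?L"
      using assms by (auto simp: card_insert_if finite_subset)
  qed
  have "sum ?g {J. J \<subseteq> I \<and> card J = k} = (1 - p a) * poisson_binomial I p k"
    unfolding poisson_binomial_def sum_distrib_left
  proof (intro sum.cong refl)
    fix J assume "J \<in> {J. J \<subseteq> I \<and> card J = k}"
    then have "insert a I - J = insert a (I - J)" using assms by auto
    then show "prod p J * (\<Prod>i\<in>insert a I - J. 1 - p i) = (1 - p a) * (prod p J * (\<Prod>i\<in>I - J. 1 - p i))"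
      using assms by simp
  qed
  moreover have "sum ?g (insert a ` ?B) = (\<Sum>J\<in>?B. p a * ((\<Prod>i\<in>J. p i) * (\<Prod>i\<in>I - J. 1 - p i)))"
  proof (subst sum.reindex)
    show "inj_on (insert a) ?B"
      using assms by (auto intro!: inj_onI dest: insert_ident[THEN iffD1, rotated 2])
    show "sum (?g \<circ> insert a) ?B = (\<Sum>J\<in>?B. p a * ((\<Prod>i\<in>J. p i) * (\<Prod>i\<in>I - J. 1 - p i)))"
    proof (intro sum.cong refl)
      fix J assume "J \<in> ?B"
      then have "J \<subseteq> I" "a \<notin> J" "finite J" "insert a I - insert a J = I - J"
        using assms finite_subset by auto
      then show "(?g \<circ> insert a) J = p a * ((\<Prod>i\<in>J. p i) * (\<Prod>i\<in>I - J. 1 - p i))"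
        by simp
    qed
  qed
  moreover have "\<dots> = p a * (case k of 0 \<Rightarrow> 0 | Suc j \<Rightarrow> poisson_binomial I p j)"
    by (auto simp: poisson_binomial_def sum_distrib_left split: nat.split)
  moreover have "poisson_binomial (insert a I) p k =
      sum ?g {J. J \<subseteq> I \<and> card J = k} + sum ?g (insert a ` ?B)"
    unfolding poisson_binomial_def split using assms by (intro sum.union_disjoint) auto
  ultimately show ?thesis by simp
qed

lemma poisson_binomial_bounds:
  assumes "finite I" "\<And>i. i \<in> I \<Longrightarrow> 0 \<le> p i \<and> p i \<le> 1"
  shows "0 \<le> poisson_binomial I p k \<and> poisson_binomial I p k \<le> 1"
  using assms
proof (induction I arbitrary: k)
  case (insert a I)
  let ?prev = "case k of 0 \<Rightarrow> 0 | Suc j \<Rightarrow> poisson_binomial I p j"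
  have p: "0 \<le> p a" "p a \<le> 1" using insert.prems by auto
  have pb: "0 \<le> poisson_binomial I p j \<and> poisson_binomial I p j \<le> 1" for j
    using insert by auto
  then have "0 \<le> ?prev" "?prev \<le> 1" by (auto split: nat.split)
  with pb[of k] p show ?case
    unfolding poisson_binomial_insert[OF insert.hyps]
    by (auto intro!: convex_bound_le add_nonneg_nonneg mult_nonneg_nonneg)
qed (simp add: poisson_binomial_empty)

text \<open>Induction on the trials. By \<open>pois_step\<close> the Poisson masses satisfy the
  recursion of \<open>poisson_binomial_insert\<close> up to \<open>2 * (p a)\<^sup>2\<close>, and
  mixing with weights \<open>1 - p a\<close> and \<open>p a\<close> does not enlarge the error
  already present.\<close>

lemma le_cam:
  assumes "finite I" "\<And>i. i \<in> I \<Longrightarrow> 0 \<le> p i \<and> p i \<le> 1"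
  shows "\<bar>poisson_binomial I p k - pois k (sum p I)\<bar> \<le> 2 * (\<Sum>i\<in>I. (p i)\<^sup>2)"
  using assms
proof (induction I arbitrary: k)
  case empty
  show ?case by (simp add: poisson_binomial_empty pois_def power_0_left)
next
  case (insert a I)
  define t where "t = sum p I"
  define e where "e = 2 * (\<Sum>i\<in>I. (p i)\<^sup>2)"
  define prev where "prev = (case k of 0 \<Rightarrow> 0 | Suc j \<Rightarrow> poisson_binomial I p j)"
  have p: "0 \<le> p a" "p a \<le> 1" and t: "0 \<le> t"
    using insert.prems by (auto simp: t_def intro!: sum_nonneg)
  have IH: "\<bar>poisson_binomial I p j - pois j t\<bar> \<le> e" for j
    using insert unfolding t_def e_def by auto
  have "0 \<le> e" by (simp add: e_def sum_nonneg)
  then have prev: "\<bar>prev - pois_prev k t\<bar> \<le> e"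
    using IH by (auto simp: prev_def pois_prev_def split: nat.split)
  have "\<bar>(1 - p a) * (poisson_binomial I p k - pois k t) + p a * (prev - pois_prev k t)\<bar>
      \<le> (1 - p a) * e + p a * e"
    using p IH[of k] prev
    by (intro order_trans[OF abs_triangle_ineq] add_mono) (auto simp: abs_mult intro!: mult_left_mono)
  then have "\<bar>(1 - p a) * (poisson_binomial I p k - pois k t) + p a * (prev - pois_prev k t)\<bar> \<le> e"
    by (simp add: algebra_simps)
  moreover have "poisson_binomial (insert a I) p k = (1 - p a) * poisson_binomial I p k + p a * prev"
    unfolding poisson_binomial_insert[OF insert.hyps] prev_def ..
  moreover note pois_step[OF t p(1), of k]
  ultimately have "\<bar>poisson_binomial (insert a I) p k - pois k (t + p a)\<bar> \<le> e + 2 * (p a)\<^sup>2"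
    by (simp add: algebra_simps)
  then show ?case
    using insert.hyps by (simp add: t_def e_def add.commute)
qed

text \<open>When all means are 0 or 1, only the \<open>J\<close> consisting of the indices with
  \<open>P i\<close> contributes. In this way a deterministic count becomes a Poisson binomial
  mass.\<close>

lemma poisson_binomial_indicator:
  assumes "finite I"
  shows "poisson_binomial I (\<lambda>i. of_bool (P i)) k = of_bool (card {i \<in> I. P i} = k)"
proof -
  have "(\<Prod>i\<in>J. of_bool (P i)) * (\<Prod>i\<in>I - J. 1 - of_bool (P i)) = (of_bool (J = {i \<in> I. P i}) :: real)"
    if "J \<subseteq> I" for J
  proof -
    have "finite J" using that assms finite_subset by auto
    then have 1: "(\<Prod>i\<in>J. of_bool (P i) :: real) = of_bool (\<forall>i\<in>J. P i)"
      by (induction J) auto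
    have "finite K \<Longrightarrow> (\<Prod>i\<in>K. 1 - of_bool (P i) :: real) = of_bool (\<forall>i\<in>K. \<not> P i)" for K
      by (induction K rule: finite_induct) auto
    with 1 that assms show ?thesis by auto
  qed
  then have "poisson_binomial I (\<lambda>i. of_bool (P i)) k =
      (\<Sum>J | J \<subseteq> I \<and> card J = k. of_bool (J = {i \<in> I. P i}))"
    unfolding poisson_binomial_def by (intro sum.cong) auto
  also have "\<dots> = of_bool (card {i \<in> I. P i} = k)"
    using assms by (simp add: of_bool_def sum.delta')
  finally show ?thesis .
qed

section \<open>Double counting and hypergeometric tails\<close>

lemma card_supersets_of_card:
  assumes "finite W" "T \<subseteq> W" "card T \<le> b"
  shows "card {B. B \<subseteq> W \<and> card B = b \<and> T \<subseteq> B} = (card W - card T) choose (b - card T)"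
proof -
  have fin: "finite T" "finite (W - T)" using assms finite_subset by auto
  have "{B. B \<subseteq> W \<and> card B = b \<and> T \<subseteq> B} = (\<union>) T ` {C. C \<subseteq> W - T \<and> card C = b - card T}"
    (is "?L = ?R")
  proof
    show "?L \<subseteq> ?R"
    proof
      fix B assume "B \<in> ?L"
      then have "B = T \<union> (B - T)" "B - T \<in> {C. C \<subseteq> W - T \<and> card C = b - card T}"
        using fin by (auto simp: card_Diff_subset)
      then show "B \<in> ?R" by blast
    qed
    show "?R \<subseteq> ?L"
    proof clarify
      fix C assume C: "C \<subseteq> W - T" "card C = b - card T"
      then have "card (T \<union> C) = card T + card C"
        using fin finite_subset by (intro card_Un_disjoint) auto
      with C assms show "T \<union> C \<subseteq> W \<and> card (T \<union> C) = b \<and> T \<subseteq> T \<union> C" by auto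
    qed
  qed
  moreover have "inj_on ((\<union>) T) {C. C \<subseteq> W - T \<and> card C = b - card T}"
    by (rule inj_onI) blast
  ultimately have "card {B. B \<subseteq> W \<and> card B = b \<and> T \<subseteq> B} = card {C. C \<subseteq> W - T \<and> card C = b - card T}"
    by (simp add: card_image)
  then show ?thesis
    using fin assms by (simp add: n_subsets card_Diff_subset)
qed

text \<open>Count the pairs \<open>(T, B)\<close> with \<open>card T = s\<close> and
  \<open>T \<subseteq> A \<inter> B\<close>, first by \<open>B\<close> and then by \<open>T\<close>.
  The factor \<open>card W choose s\<close> on the left avoids a division, so the identity lives in
  the natural numbers and covers degenerate sizes.\<close>

lemma sum_choose_card_Int:
  assumes W: "finite W" and A: "A \<subseteq> W"
  shows "(card W choose s) * (\<Sum>B | B \<subseteq> W \<and> card B = b. card (A \<inter> B) choose s)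
    = (card W choose b) * (b choose s) * (card A choose s)"
proof (cases "s \<le> b \<and> b \<le> card W")
  case True
  have A': "finite A" using A W finite_subset by blast
  have fin: "finite {B. B \<subseteq> W \<and> card B = b}" "finite {T. T \<subseteq> A \<and> card T = s}"
    using W A' by auto
  have "(\<Sum>B | B \<subseteq> W \<and> card B = b. card (A \<inter> B) choose s)
      = (\<Sum>B | B \<subseteq> W \<and> card B = b. \<Sum>T | T \<in> {T. T \<subseteq> A \<and> card T = s} \<and> T \<subseteq> B. 1)"
  proof (intro sum.cong refl)
    fix B assume "B \<in> {B. B \<subseteq> W \<and> card B = b}"
    have "{T. T \<subseteq> A \<inter> B \<and> card T = s} = {T \<in> {T. T \<subseteq> A \<and> card T = s}. T \<subseteq> B}" by auto
    then show "(card (A \<inter> B) choose s) = (\<Sum>T | T \<in> {T. T \<subseteq> A \<and> card T = s} \<and> T \<subseteq> B. 1)"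
      using n_subsets[of "A \<inter> B" s] A' by simp
  qed
  also have "\<dots> = (\<Sum>T | T \<subseteq> A \<and> card T = s.
      \<Sum>B | B \<in> {B. B \<subseteq> W \<and> card B = b} \<and> T \<subseteq> B. 1)"
    using fin by (rule sum.swap_restrict)
  also have "\<dots> = (\<Sum>T | T \<subseteq> A \<and> card T = s. (card W - s) choose (b - s))"
  proof (intro sum.cong refl)
    fix T assume "T \<in> {T. T \<subseteq> A \<and> card T = s}"
    then have "card {B. B \<subseteq> W \<and> card B = b \<and> T \<subseteq> B} = (card W - s) choose (b - s)"
      using card_supersets_of_card[OF W, of T b] A True by auto
    then show "(\<Sum>B | B \<in> {B. B \<subseteq> W \<and> card B = b} \<and> T \<subseteq> B. 1) = (card W - s) choose (b - s)"
      by (simp add: conj_assoc)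
  qed
  also have "\<dots> = (card A choose s) * ((card W - s) choose (b - s))"
    using A' by (simp add: n_subsets)
  finally have "(\<Sum>B | B \<subseteq> W \<and> card B = b. card (A \<inter> B) choose s)
      = (card A choose s) * ((card W - s) choose (b - s))" .
  \<comment> \<open>\<open>choose_mult\<close> exchanges
    \<open>(card W choose s) * ((card W - s) choose (b - s))\<close> for
    \<open>(card W choose b) * (b choose s)\<close>.\<close>
  then show ?thesis
    using choose_mult[of s b "card W"] True by simp
next
  \<comment> \<open>If \<open>b < s\<close>, no intersection reaches size \<open>s\<close>; if
    \<open>b > card W\<close>, there is no \<open>B\<close>. Both sides are 0.\<close>
  case False
  have "card (A \<inter> B) choose s = 0" if "B \<subseteq> W" "card B = b" for B
  proof -
    have "card (A \<inter> B) \<le> card B" "card B \<le> card W"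
      using that W finite_subset by (auto intro!: card_mono)
    with False that show ?thesis by auto
  qed
  then have "(\<Sum>B | B \<subseteq> W \<and> card B = b. card (A \<inter> B) choose s) = 0" by (intro sum.neutral) auto
  with False show ?thesis by auto
qed

text \<open>For \<open>b \<le> card W\<close> this is a hypergeometric tail. For larger
  \<open>b\<close> it is 0 by division by zero, so the bounds 0 and 1 hold for every
  \<open>b\<close>.\<close>

definition overlap_prob :: "'w set \<Rightarrow> nat \<Rightarrow> 'w set \<Rightarrow> nat \<Rightarrow> real" where
  "overlap_prob W s A b =
     real (card {B. B \<subseteq> W \<and> card B = b \<and> s \<le> card (A \<inter> B)}) / real (card W choose b)"

lemma overlap_prob_bounds:
  assumes "finite W"
  shows "0 \<le> overlap_prob W s A b" "overlap_prob W s A b \<le> 1"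
proof -
  have "card {B. B \<subseteq> W \<and> card B = b \<and> s \<le> card (A \<inter> B)} \<le> card {B. B \<subseteq> W \<and> card B = b}"
    using assms by (intro card_mono) auto
  also have "\<dots> = card W choose b" using assms by (rule n_subsets)
  finally show "overlap_prob W s A b \<le> 1"
    unfolding overlap_prob_def by (intro divide_le_eq_1[THEN iffD2]) (auto simp: less_le)
  show "0 \<le> overlap_prob W s A b" by (simp add: overlap_prob_def)
qed

text \<open>A first moment bound: the indicator of \<open>s \<le> y\<close> is at most
  \<open>y choose s\<close>, whose average over \<open>B\<close> is given by
  \<open>sum_choose_card_Int\<close>.\<close>

lemma overlap_prob_upper:
  assumes W: "finite W" and A: "A \<subseteq> W" and s: "s \<le> card W" and b: "b \<le> card W"
  shows "overlap_prob W s A b \<le> real (card A choose s) * real (b choose s) / real (card W choose s)"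
    (is "_ \<le> ?u")
proof -
  let ?S = "{B. B \<subseteq> W \<and> card B = b}"
  have S: "finite ?S" using W by auto
  have pos: "0 < card W choose s" "0 < card W choose b" using s b by auto
  have "card {B. B \<subseteq> W \<and> card B = b \<and> s \<le> card (A \<inter> B)} = (\<Sum>B\<in>?S. of_bool (s \<le> card (A \<inter> B)))"
    using S by (auto simp: of_bool_def sum.If_cases Int_def conj_assoc)
  also have "\<dots> \<le> (\<Sum>B\<in>?S. card (A \<inter> B) choose s)"
    by (intro sum_mono) (auto simp: Suc_le_eq)
  finally have "(card W choose s) * card {B. B \<subseteq> W \<and> card B = b \<and> s \<le> card (A \<inter> B)}
      \<le> (card W choose b) * (b choose s) * (card A choose s)"
    unfolding sum_choose_card_Int[OF W A, symmetric] by (rule mult_left_mono) simp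
  then have "real (card W choose s) * real (card {B. B \<subseteq> W \<and> card B = b \<and> s \<le> card (A \<inter> B)})
      \<le> real (card W choose b) * real (b choose s) * real (card A choose s)"
    unfolding of_nat_mult[symmetric] of_nat_le_iff .
  then show ?thesis
    using pos by (simp add: overlap_prob_def field_simps)
qed

text \<open>
  If \<open>Y \<ge> s\<close> then \<open>(Y choose s) - 1 \<le> (Y - s) * (Y choose s) = (s + 1) * (Y choose (s + 1))\<close>,
  and the expectation of the right-hand side is again given by double counting.
\<close>

lemma overlap_prob_lower:
  assumes W: "finite W" and A: "A \<subseteq> W" and s: "s < card W" and b: "b \<le> card W"
  shows "real (card A choose s) * real (b choose s) / real (card W choose s)
      * (1 - excess s (card A) * excess s b / (real (card W) - real s)) \<le> overlap_prob W s A b"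
proof -
  let ?S = "{B. B \<subseteq> W \<and> card B = b}"
  let ?m = "card W" and ?a = "card A"
  have S: "finite ?S" using W by auto
  \<comment> \<open>The strict inequality \<open>s < card W\<close> makes
    \<open>?m choose Suc s\<close> positive, so that it may be divided by when \<open>?E2\<close> is
    computed.\<close>
  have pos: "0 < ?m choose s" "0 < ?m choose b" "0 < ?m choose Suc s" using s b by auto
  have step: "real (Suc s) * real (y choose Suc s) = real (y choose s) * excess s y" for y
  proof (cases "s \<le> y")
    case True
    have "Suc s * (y choose Suc s) = (y choose s) * (y - s)"
      by (metis binomial_absorb_comp binomial_absorption mult.commute)
    then show ?thesis using True
      by (simp only: of_nat_mult [symmetric]) (simp add: excess_def of_nat_diff)
  qed (simp add: excess_def)
  have E: "real (?m choose t) * (\<Sum>B\<in>?S. real (card (A \<inter> B) choose t))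
      = real (?m choose b) * real (b choose t) * real (?a choose t)" for t
    using arg_cong[OF sum_choose_card_Int[OF W A, of t b], of real] by simp
  \<comment> \<open>Equality holds for \<open>y \<le> s\<close>; for larger \<open>y\<close> the
    excess is at least 1 and the left side is nonpositive.\<close>
  have "real (y choose s) - real (Suc s) * real (y choose Suc s) \<le> of_bool (s \<le> y)" for y
    unfolding step
  proof (cases "Suc s \<le> y")
    case True
    then have "1 \<le> excess s y" by (simp add: excess_def)
    then have "real (y choose s) * 1 \<le> real (y choose s) * excess s y" by (intro mult_left_mono) auto
    then have "real (y choose s) - real (y choose s) * excess s y \<le> 0" by simp
    also have "0 \<le> (of_bool (s \<le> y) :: real)" by simp
    finally show "real (y choose s) - real (y choose s) * excess s y \<le> of_bool (s \<le> y)" .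
  next
    case False
    then show "real (y choose s) - real (y choose s) * excess s y \<le> of_bool (s \<le> y)"
      by (cases "y = s") (auto simp: excess_def)
  qed
  then have "(\<Sum>B\<in>?S. real (card (A \<inter> B) choose s) - real (Suc s) * real (card (A \<inter> B) choose Suc s))
      \<le> (\<Sum>B\<in>?S. of_bool (s \<le> card (A \<inter> B)))"
    by (intro sum_mono)
  also have "\<dots> = real (card {B. B \<subseteq> W \<and> card B = b \<and> s \<le> card (A \<inter> B)})"
    using S by (auto simp: of_bool_def sum.If_cases Int_def conj_assoc)
  finally have "(\<Sum>B\<in>?S. real (card (A \<inter> B) choose s)) / real (?m choose b)
      - real (Suc s) * (\<Sum>B\<in>?S. real (card (A \<inter> B) choose Suc s)) / real (?m choose b)
      \<le> overlap_prob W s A b" (is "?E1 - ?E2 \<le> _")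
    unfolding overlap_prob_def
    by (simp only: sum_subtractf sum_distrib_left [symmetric] diff_divide_distrib [symmetric])
       (rule divide_right_mono, auto)
  moreover have "?E1 = real (?a choose s) * real (b choose s) / real (?m choose s)"
    using E[of s] pos by (simp add: field_simps)
  moreover have "?E2 = real (?a choose s) * real (b choose s) / real (?m choose s)
      * (excess s ?a * excess s b / (real ?m - real s))"
  proof -
    have m: "excess s ?m = real ?m - real s" using s by (simp add: excess_def)
    have "?E2 = real (Suc s) * (real (b choose Suc s) * real (?a choose Suc s) / real (?m choose Suc s))"
      using E[of "Suc s"] pos by (simp add: field_simps del: of_nat_Suc)
    \<comment> \<open>Expanding the fraction by \<open>Suc s\<close> lets \<open>step\<close> act on
      \<open>b\<close>, \<open>card A\<close> and \<open>card W\<close> at once; the last one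
      produces the denominator \<open>card W - s\<close>.\<close>
    also have "\<dots> = (real (Suc s) * real (b choose Suc s)) * (real (Suc s) * real (?a choose Suc s))
        / (real (Suc s) * real (?m choose Suc s))"
      by (simp del: of_nat_Suc)
    also have "\<dots> = real (?a choose s) * real (b choose s) / real (?m choose s)
      * (excess s ?a * excess s b / (real ?m - real s))"
      unfolding step m by simp
    finally show ?thesis .
  qed
  ultimately show ?thesis by (simp only: right_diff_distrib mult_1_right)
qed

section \<open>Poisson approximation for fixed sets, in terms of the three statistics\<close>

lemma lambda_stat_nonneg: "0 \<le> lambda_stat m s n x"
  by (simp add: lambda_stat_def u_weight_def sum_nonneg)

lemma kappa1_nonneg: "0 \<le> kappa1 m s n x"
  by (simp add: kappa1_def sum_nonneg)

lemma sum_overlap_prob_sq_le_kappa1: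
  assumes W: "finite W" and S: "\<And>i. i \<in> {1..n} \<Longrightarrow> S i \<subseteq> W" and n: "1 \<le> n"
    and s: "s \<le> card W"
  shows "(\<Sum>i=2..n. (overlap_prob W s (S 1) (card (S i)))\<^sup>2) \<le> kappa1 (card W) s n (\<lambda>i. card (S i))"
  unfolding kappa1_def sum_distrib_left
proof (rule sum_mono)
  fix i assume "i \<in> {2..n}"
  then have "overlap_prob W s (S 1) (card (S i)) \<le>
      inverse (real (card W choose s)) * u_weight s (\<lambda>i. card (S i)) i"
    using overlap_prob_upper[OF W S[of 1] s, of "card (S i)"] S[of i] n W
    by (auto simp: card_mono u_weight_def field_simps)
  then show "(overlap_prob W s (S 1) (card (S i)))\<^sup>2 \<le>
      (inverse (real (card W choose s)))\<^sup>2 * (u_weight s (\<lambda>i. card (S i)) i)\<^sup>2"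
    using overlap_prob_bounds(1)[OF W]
    by (simp flip: power_mult_distrib) (intro power_mono, auto)
qed

text \<open>The upper and lower bounds for \<open>overlap_prob\<close> enclose each tail, with a gap
  of at most the matching term of \<open>kappa2\<close>. The assumption \<open>small\<close> handles
  the case that \<open>S 1\<close> is all of \<open>W\<close>, where the denominator in
  \<open>kappa2\<close> vanishes.\<close>

lemma sum_overlap_prob_approx:
  assumes W: "finite W" and S: "\<And>i. i \<in> {1..n} \<Longrightarrow> S i \<subseteq> W" and n: "1 \<le> n"
    and s: "s \<le> card W" and small: "kappa1 (card W) s n (\<lambda>i. card (S i)) < 1"
  shows "\<bar>(\<Sum>i=2..n. overlap_prob W s (S 1) (card (S i))) - lambda_stat (card W) s n (\<lambda>i. card (S i))\<bar>
    \<le> kappa2 (card W) s n (\<lambda>i. card (S i))"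
proof -
  let ?x = "\<lambda>i. card (S i)" and ?m = "card W"
  define h where "h i = overlap_prob W s (S 1) (?x i)" for i
  define v where "v i = inverse (real (?m choose s)) * u_weight s ?x i" for i
  define c where "c i = excess s (?x 1) / (real ?m - real (?x 1)) * inverse (real (?m choose s))
    * (u_weight s ?x i * excess s (?x i))" for i
  have S1: "S 1 \<subseteq> W" using S n by auto
  have x1: "?x 1 \<le> ?m" using S1 W by (rule card_mono[rotated])
  have v0: "0 \<le> v i" for i by (simp add: v_def u_weight_def)
  have "\<bar>h i - v i\<bar> \<le> c i" if i: "i \<in> {2..n}" for i
  proof -
    have Si: "S i \<subseteq> W" using S i by auto
    have xi: "?x i \<le> ?m" using Si W by (rule card_mono[rotated])
    have veq: "v i = real (?x 1 choose s) * real (?x i choose s) / real (?m choose s)"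
      by (simp add: v_def u_weight_def field_simps)
    have up: "h i \<le> v i"
      unfolding h_def veq by (rule overlap_prob_upper[OF W S1 s xi])
    show ?thesis
    proof (cases "?x 1 < s")
      case True
      then have "v i = 0" by (simp add: veq)
      moreover have "0 \<le> h i" unfolding h_def by (rule overlap_prob_bounds(1)[OF W])
      moreover have "c i = 0" using True by (simp add: c_def excess_def)
      ultimately show ?thesis using up by simp
    next
      case False
      show ?thesis
      proof (cases "?x 1 = ?m")
        \<comment> \<open>Here \<open>c i = 0\<close> by division by zero, so \<open>h i\<close> and
          \<open>v i\<close> must agree exactly. They do: \<open>v i\<close> is a nonnegative
          integer whose square is at most \<open>kappa1 < 1\<close>, so both vanish.\<close>
        case True
        then have "v i = real (?x i choose s)" using s by (simp add: veq)
        have "(v i)\<^sup>2 \<le> (\<Sum>i=2..n. (v i)\<^sup>2)" using i by (intro member_le_sum) auto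
        also have "\<dots> = kappa1 ?m s n ?x"
          by (simp add: kappa1_def v_def sum_distrib_left power_mult_distrib)
        finally have "v i < 1" using small by (meson le_less_trans not_le one_le_power)
        then have "v i = 0" using \<open>v i = real (?x i choose s)\<close> by simp
        moreover have "0 \<le> h i" unfolding h_def by (rule overlap_prob_bounds(1)[OF W])
        moreover have "c i = 0" using True by (simp add: c_def)
        ultimately show ?thesis using up by simp
      next
        case neq: False
        then have lt: "s < ?m" "?x 1 < ?m" using x1 False by auto
        have "v i * (1 - excess s (?x 1) * excess s (?x i) / (real ?m - real s)) \<le> h i"
          unfolding h_def veq by (rule overlap_prob_lower[OF W S1 lt(1) xi])
        then have "v i - h i \<le> v i * (excess s (?x 1) * excess s (?x i) / (real ?m - real s))"
          by (simp add: algebra_simps)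
        \<comment> \<open>In this case \<open>s \<le> card (S 1)\<close>, so passing from
          \<open>card W - s\<close> to \<open>card W - card (S 1)\<close> shrinks a positive
          denominator and reaches the form used in \<open>kappa2\<close>.\<close>
        also have "\<dots> \<le> v i * (excess s (?x 1) * excess s (?x i) / (real ?m - real (?x 1)))"
          using False lt v0[of i]
          by (intro mult_left_mono divide_left_mono mult_nonneg_nonneg mult_pos_pos) (auto simp: excess_def)
        also have "\<dots> = c i" by (simp add: v_def c_def)
        finally show ?thesis using up by simp
      qed
    qed
  qed
  then have "\<bar>\<Sum>i=2..n. h i - v i\<bar> \<le> (\<Sum>i=2..n. c i)"
    by (intro order_trans[OF sum_abs] sum_mono)
  then show ?thesis
    by (simp add: h_def v_def c_def lambda_stat_def kappa2_def sum_subtractf sum_distrib_left)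
qed

text \<open>When \<open>m < s\<close>, all \<open>overlap_prob\<close> vanish, and so do all the statistics, by \<open>inverse 0 = 0\<close>.\<close>

lemma poisson_binomial_overlap_approx:
  assumes W: "finite W" and S: "\<And>i. i \<in> {1..n} \<Longrightarrow> S i \<subseteq> W" and n: "1 \<le> n"
    and small: "kappa1 (card W) s n (\<lambda>i. card (S i)) < 1"
  shows "\<bar>poisson_binomial {2..n} (\<lambda>i. overlap_prob W s (S 1) (card (S i))) k
      - pois k (lambda_stat (card W) s n (\<lambda>i. card (S i)))\<bar>
    \<le> 2 * kappa1 (card W) s n (\<lambda>i. card (S i)) + kappa2 (card W) s n (\<lambda>i. card (S i))"
proof -
  define h where "h i = overlap_prob W s (S 1) (card (S i))" for i
  have h: "0 \<le> h i" "h i \<le> 1" for i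
    unfolding h_def using overlap_prob_bounds[OF W] by auto
  have 1: "(\<Sum>i=2..n. (h i)\<^sup>2) \<le> kappa1 (card W) s n (\<lambda>i. card (S i))
      \<and> \<bar>sum h {2..n} - lambda_stat (card W) s n (\<lambda>i. card (S i))\<bar> \<le> kappa2 (card W) s n (\<lambda>i. card (S i))"
  proof (cases "s \<le> card W")
    case True
    then show ?thesis
      unfolding h_def
      using sum_overlap_prob_sq_le_kappa1[OF W S n] sum_overlap_prob_approx[OF W S n _ small] by auto
  next
    case False
    have "card (S 1 \<inter> B) < s" for B
    proof -
      have "card (S 1 \<inter> B) \<le> card W" using S[of 1] n W by (intro card_mono) auto
      with False show ?thesis by simp
    qed
    then have "h i = 0" for i
      by (simp add: h_def overlap_prob_def not_le[symmetric])
    moreover have "inverse (real (card W choose s)) = 0" using False by simp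
    ultimately show ?thesis
      unfolding kappa1_def kappa2_def lambda_stat_def by (simp only:) simp
  qed
  \<comment> \<open>Le Cam's inequality costs at most \<open>2 * kappa1\<close>; moving the mean
    from \<open>sum h {2..n}\<close> to \<open>lambda_stat\<close> costs at most
    \<open>kappa2\<close>.\<close>
  have "\<bar>poisson_binomial {2..n} h k - pois k (sum h {2..n})\<bar> \<le> 2 * (\<Sum>i=2..n. (h i)\<^sup>2)"
    using h by (intro le_cam) auto
  moreover have "\<bar>pois k (sum h {2..n}) - pois k (lambda_stat (card W) s n (\<lambda>i. card (S i)))\<bar>
      \<le> \<bar>sum h {2..n} - lambda_stat (card W) s n (\<lambda>i. card (S i))\<bar>"
    using h by (intro pois_lipschitz lambda_stat_nonneg sum_nonneg) auto
  ultimately show ?thesis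
    using 1 unfolding h_def[symmetric] by linarith
qed

section \<open>The degree of the first vertex and averages over the random sets\<close>

lemma graph_degree_intersection_graph:
  assumes "1 \<le> n"
  shows "graph_degree (intersection_graph s n S) 1 = card {i \<in> {2..n}. s \<le> card (S 1 \<inter> S i)}"
proof -
  have "out_arcs (with_proj (intersection_graph s n S)) 1
      = Pair 1 ` {i \<in> {2..n}. s \<le> card (S 1 \<inter> S i)}"
    using assms by (auto simp: out_arcs_def intersection_graph_def)
  then show ?thesis
    unfolding graph_degree_def out_degree_def by (simp add: card_image inj_on_def)
qed

context uniform_random_subsets
begin

lemma measurable_D: "i \<in> {1..n} \<Longrightarrow> D i \<in> measurable M (count_space (Pow W))"
  using indep_D by (auto simp: indep_vars_def)

lemma D_subset: "i \<in> {1..n} \<Longrightarrow> \<omega> \<in> space M \<Longrightarrow> D i \<omega> \<subseteq> W"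
  using measurable_space[OF measurable_D, of i \<omega>] by simp

text \<open>A function of the first \<open>n\<close> sets factors through a finite discrete product
  space. It is therefore measurable, and bounded by the sum of its absolute values over that
  space.\<close>

lemma
  fixes \<Phi> :: "(nat \<Rightarrow> 'w set) \<Rightarrow> real"
  assumes "\<And>S T. (\<And>i. i \<in> {1..n} \<Longrightarrow> S i = T i) \<Longrightarrow> \<Phi> S = \<Phi> T"
  shows measurable_fun_D: "(\<lambda>\<omega>. \<Phi> (\<lambda>i. D i \<omega>)) \<in> borel_measurable M"
    and integrable_fun_D: "integrable M (\<lambda>\<omega>. \<Phi> (\<lambda>i. D i \<omega>))"
proof -
  let ?P = "PiE {1..n} (\<lambda>_. Pow W)"
  have fin: "finite ?P" using finite_W by (intro finite_PiE) auto
  have eq: "\<Phi> (\<lambda>i. D i \<omega>) = \<Phi> (\<lambda>i\<in>{1..n}. D i \<omega>)" for \<omega>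
    by (rule assms) simp
  have "(\<lambda>\<omega>. \<lambda>i\<in>{1..n}. D i \<omega>) \<in> measurable M (PiM {1..n} (\<lambda>_. count_space (Pow W)))"
    by (intro measurable_restrict measurable_D)
  also have "PiM {1..n} (\<lambda>_. count_space (Pow W)) = count_space ?P"
    using finite_W by (intro count_space_PiM_finite) (auto intro: countable_finite)
  finally have meas: "(\<lambda>\<omega>. \<lambda>i\<in>{1..n}. D i \<omega>) \<in> measurable M (count_space ?P)" .
  show rv: "(\<lambda>\<omega>. \<Phi> (\<lambda>i. D i \<omega>)) \<in> borel_measurable M"
    unfolding eq by (rule measurable_compose[OF meas]) simp
  show "integrable M (\<lambda>\<omega>. \<Phi> (\<lambda>i. D i \<omega>))"
  proof (rule integrable_const_bound[OF _ rv], rule AE_I2)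
    fix \<omega> assume "\<omega> \<in> space M"
    then have mem: "(\<lambda>i\<in>{1..n}. D i \<omega>) \<in> ?P" using measurable_space[OF meas] by simp
    then show "norm (\<Phi> (\<lambda>i. D i \<omega>)) \<le> (\<Sum>S\<in>?P. norm (\<Phi> S))"
      unfolding eq using member_le_sum[OF mem _ fin, of "\<lambda>S. norm (\<Phi> S)"] by simp
  qed
qed

lemma integrable_comp_D: "i \<in> {1..n} \<Longrightarrow> integrable M (\<lambda>\<omega>. f (D i \<omega>))" for f :: "'w set \<Rightarrow> real"
  by (rule integrable_fun_D[of "\<lambda>S. f (S i)"]) simp

lemma expectation_comp_D:
  fixes f :: "'w set \<Rightarrow> real"
  assumes i: "i \<in> {1..n}"
  shows "expectation (\<lambda>\<omega>. f (D i \<omega>)) = (\<Sum>B\<in>Pow W. f B * prob {\<omega> \<in> space M. D i \<omega> = B})"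
proof -
  have ev: "{\<omega> \<in> space M. D i \<omega> = B} \<in> events" if "B \<in> Pow W" for B
    using measurable_sets[OF measurable_D[OF i], of "{B}"] that
    by (simp add: vimage_def Int_def conj_commute)
  have "expectation (\<lambda>\<omega>. f (D i \<omega>))
      = expectation (\<lambda>\<omega>. \<Sum>B\<in>Pow W. f B * indicator {\<omega> \<in> space M. D i \<omega> = B} \<omega>)"
  proof (intro Bochner_Integration.integral_cong refl)
    fix \<omega> assume w: "\<omega> \<in> space M"
    then have "(\<Sum>B\<in>Pow W. f B * indicator {\<omega> \<in> space M. D i \<omega> = B} \<omega>)
        = (\<Sum>B\<in>Pow W. if D i \<omega> = B then f B else 0)"
      by (intro sum.cong) (auto simp: indicator_def)
    then show "f (D i \<omega>) = (\<Sum>B\<in>Pow W. f B * indicator {\<omega> \<in> space M. D i \<omega> = B} \<omega>)"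
      using D_subset[OF i w] finite_W by (simp add: sum.delta')
  qed
  also have "\<dots> = (\<Sum>B\<in>Pow W. f B * prob {\<omega> \<in> space M. D i \<omega> = B})"
    using ev by (subst Bochner_Integration.integral_sum)
      (auto intro!: integrable_mult_right simp: less_top [symmetric] Int_absorb1)
  finally show ?thesis .
qed

text \<open>Group the values of \<open>D i\<close> by size. Within one size the law is uniform, so
  the indicator and the tail have the same sum over that group.\<close>

lemma expectation_overlap:
  assumes i: "i \<in> {1..n}"
  shows "expectation (\<lambda>\<omega>. of_bool (s \<le> card (A \<inter> D i \<omega>))) = expectation (\<lambda>\<omega>. overlap_prob W s A (card (D i \<omega>)))"
proof -
  \<comment> \<open>By \<open>prob_D\<close>, this is the probability of each single subset of size
    \<open>b\<close>.\<close>
  define g where "g b = prob {\<omega> \<in> space M. card (D i \<omega>) = b} / real (card W choose b)" for b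
  have E: "expectation (\<lambda>\<omega>. f (D i \<omega>)) = (\<Sum>b\<le>card W. g b * (\<Sum>B | B \<subseteq> W \<and> card B = b. f B))"
    for f :: "'w set \<Rightarrow> real"
  proof -
    have "expectation (\<lambda>\<omega>. f (D i \<omega>)) = (\<Sum>B\<in>Pow W. f B * g (card B))"
      unfolding expectation_comp_D[OF i] by (intro sum.cong) (auto simp: prob_D[OF i] g_def)
    also have "\<dots> = (\<Sum>b\<le>card W. \<Sum>B | B \<in> Pow W \<and> card B = b. f B * g (card B))"
      using finite_W by (intro sum.group[symmetric]) (auto intro: card_mono)
    also have "\<dots> = (\<Sum>b\<le>card W. g b * (\<Sum>B | B \<subseteq> W \<and> card B = b. f B))"
      by (auto simp: sum_distrib_left mult.commute intro!: sum.cong)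
    finally show ?thesis .
  qed
  have "(\<Sum>B | B \<subseteq> W \<and> card B = b. of_bool (s \<le> card (A \<inter> B)))
      = (\<Sum>B | B \<subseteq> W \<and> card B = b. overlap_prob W s A (card B))" if "b \<le> card W" for b
  proof -
    have "(\<Sum>B | B \<subseteq> W \<and> card B = b. overlap_prob W s A (card B))
        = real (card W choose b) * overlap_prob W s A b"
      using finite_W by (simp add: n_subsets)
    also have "\<dots> = real (card {B. B \<subseteq> W \<and> card B = b \<and> s \<le> card (A \<inter> B)})"
      using that by (simp add: overlap_prob_def)
    finally show ?thesis
      using finite_W by (simp add: of_bool_def sum.If_cases Int_def conj_assoc)
  qed
  then show ?thesis
    using E[of "\<lambda>B. of_bool (s \<le> card (A \<inter> B))"] E[of "\<lambda>B. overlap_prob W s A (card B)"] by simp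
qed

text \<open>Split according to the value \<open>A\<close> of \<open>D 1\<close>. With
  \<open>A\<close> fixed, the integrand is a product of functions of separate independent
  sets.\<close>

lemma expectation_prod_D1:
  fixes F :: "nat \<Rightarrow> 'w set \<Rightarrow> 'w set \<Rightarrow> real"
  assumes n: "1 \<le> n"
  shows "expectation (\<lambda>\<omega>. \<Prod>i\<in>{2..n}. F i (D 1 \<omega>) (D i \<omega>))
    = (\<Sum>A\<in>Pow W. expectation (\<lambda>\<omega>. of_bool (D 1 \<omega> = A)) * (\<Prod>i\<in>{2..n}. expectation (\<lambda>\<omega>. F i A (D i \<omega>))))"
proof -
  \<comment> \<open>The indicator of \<open>D 1 = A\<close> becomes the factor with index 1, so
    independence of the whole family applies to a single product.\<close>
  define Y where "Y A i B = (if i = 1 then of_bool (B = A) else F i A B)" for A i B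
  have set: "{1..n} = insert 1 {2..n}" using n by auto
  have prodY: "(\<Prod>i\<in>{1..n}. Y A i (D i \<omega>)) = of_bool (D 1 \<omega> = A) * (\<Prod>i\<in>{2..n}. F i A (D i \<omega>))" for A \<omega>
    unfolding set by (auto simp: Y_def intro!: prod.cong)
  have indep: "indep_vars (\<lambda>_. borel) (\<lambda>i \<omega>. Y A i (D i \<omega>)) {1..n}" for A
    by (rule indep_vars_compose2[OF indep_D]) simp
  have int: "integrable M (\<lambda>\<omega>. Y A i (D i \<omega>))" if "i \<in> {1..n}" for A i
    using that by (rule integrable_comp_D)
  have "expectation (\<lambda>\<omega>. \<Prod>i\<in>{2..n}. F i (D 1 \<omega>) (D i \<omega>))
      = expectation (\<lambda>\<omega>. \<Sum>A\<in>Pow W. \<Prod>i\<in>{1..n}. Y A i (D i \<omega>))"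
  proof (intro Bochner_Integration.integral_cong refl)
    fix \<omega> assume "\<omega> \<in> space M"
    then have "D 1 \<omega> \<in> Pow W" using D_subset[of 1] n by auto
    moreover have "(\<Sum>A\<in>Pow W. \<Prod>i\<in>{1..n}. Y A i (D i \<omega>))
        = (\<Sum>A\<in>Pow W. if D 1 \<omega> = A then \<Prod>i\<in>{2..n}. F i A (D i \<omega>) else 0)"
      unfolding prodY by (intro sum.cong) auto
    ultimately show "(\<Prod>i\<in>{2..n}. F i (D 1 \<omega>) (D i \<omega>)) = (\<Sum>A\<in>Pow W. \<Prod>i\<in>{1..n}. Y A i (D i \<omega>))"
      using finite_W by (simp add: sum.delta')
  qed
  also have "\<dots> = (\<Sum>A\<in>Pow W. expectation (\<lambda>\<omega>. \<Prod>i\<in>{1..n}. Y A i (D i \<omega>)))"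
    using indep int by (intro Bochner_Integration.integral_sum indep_vars_integrable) auto
  also have "\<dots> = (\<Sum>A\<in>Pow W. \<Prod>i\<in>{1..n}. expectation (\<lambda>\<omega>. Y A i (D i \<omega>)))"
    using indep int by (intro sum.cong indep_vars_lebesgue_integral) auto
  also have "\<dots> = (\<Sum>A\<in>Pow W. expectation (\<lambda>\<omega>. of_bool (D 1 \<omega> = A)) * (\<Prod>i\<in>{2..n}. expectation (\<lambda>\<omega>. F i A (D i \<omega>))))"
    unfolding set by (auto simp: Y_def intro!: sum.cong prod.cong)
  finally show ?thesis .
qed

text \<open>
  Since a Poisson binomial mass is a sum of products and the sets are independent, its expectation
  only depends on the conditional means of the entries given \<open>D 1\<close>; no conditioning on the sizes
  is needed.
\<close>

lemma expectation_poisson_binomial_cong: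
  fixes F G :: "'w set \<Rightarrow> 'w set \<Rightarrow> real"
  assumes n: "1 \<le> n"
    and eq: "\<And>A i. A \<subseteq> W \<Longrightarrow> i \<in> {2..n} \<Longrightarrow>
      expectation (\<lambda>\<omega>. F A (D i \<omega>)) = expectation (\<lambda>\<omega>. G A (D i \<omega>))"
  shows "expectation (\<lambda>\<omega>. poisson_binomial {2..n} (\<lambda>i. F (D 1 \<omega>) (D i \<omega>)) k)
    = expectation (\<lambda>\<omega>. poisson_binomial {2..n} (\<lambda>i. G (D 1 \<omega>) (D i \<omega>)) k)"
proof -
  \<comment> \<open>This merges the two products into one over \<open>{2..n}\<close>. Each factor is
    affine in its own entry, so its expectation is determined by that of the entry.\<close>
  define t where "t J i x = (if i \<in> J then x else 1 - x :: real)" for J and i :: nat and x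
  have pb: "poisson_binomial {2..n} p k = (\<Sum>J | J \<subseteq> {2..n} \<and> card J = k. \<Prod>i\<in>{2..n}. t J i (p i))" for p
    unfolding poisson_binomial_def
  proof (intro sum.cong refl)
    fix J assume "J \<in> {J. J \<subseteq> {2..n} \<and> card J = k}"
    then have "{2..n} \<inter> J = J" "{2..n} \<inter> - J = {2..n} - J" by auto
    then show "(\<Prod>i\<in>J. p i) * (\<Prod>i\<in>{2..n} - J. 1 - p i) = (\<Prod>i\<in>{2..n}. t J i (p i))"
      unfolding t_def by (simp add: prod.If_cases)
  qed
  have int: "integrable M (\<lambda>\<omega>. \<Prod>i\<in>{2..n}. t J i (H (D 1 \<omega>) (D i \<omega>)))" for J and H :: "'w set \<Rightarrow> 'w set \<Rightarrow> real"
    using n by (intro integrable_fun_D[of "\<lambda>S. \<Prod>i\<in>{2..n}. t J i (H (S 1) (S i))"]) (auto intro!: prod.cong)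
  have "expectation (\<lambda>\<omega>. \<Prod>i\<in>{2..n}. t J i (F (D 1 \<omega>) (D i \<omega>)))
      = expectation (\<lambda>\<omega>. \<Prod>i\<in>{2..n}. t J i (G (D 1 \<omega>) (D i \<omega>)))" for J
  proof -
    have "expectation (\<lambda>\<omega>. t J i (F A (D i \<omega>))) = expectation (\<lambda>\<omega>. t J i (G A (D i \<omega>)))"
      if "A \<subseteq> W" "i \<in> {2..n}" for A i
    proof -
      have "i \<in> {1..n}" using that by auto
      from integrable_comp_D[OF this, of "F A"] integrable_comp_D[OF this, of "G A"] show ?thesis
        using eq[OF that] by (cases "i \<in> J") (simp_all add: t_def prob_space)
    qed
    then show ?thesis
      using expectation_prod_D1[OF n, of "\<lambda>i A B. t J i (F A B)"]
        expectation_prod_D1[OF n, of "\<lambda>i A B. t J i (G A B)"]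
      by (auto intro!: sum.cong prod.cong)
  qed
  then show ?thesis
    unfolding pb by (simp add: Bochner_Integration.integral_sum int del: One_nat_def)
qed

lemma
  assumes "1 \<le> n"
  shows measurable_lambda_stat: "(\<lambda>\<omega>. lambda_stat m s n (\<lambda>i. card (D i \<omega>))) \<in> borel_measurable M"
    and measurable_kappa1: "(\<lambda>\<omega>. kappa1 m s n (\<lambda>i. card (D i \<omega>))) \<in> borel_measurable M"
    and measurable_kappa2: "(\<lambda>\<omega>. kappa2 m s n (\<lambda>i. card (D i \<omega>))) \<in> borel_measurable M"
proof -
  show "(\<lambda>\<omega>. lambda_stat m s n (\<lambda>i. card (D i \<omega>))) \<in> borel_measurable M"
    using assms by (intro measurable_fun_D[of "\<lambda>S. lambda_stat m s n (\<lambda>i. card (S i))"])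
      (simp add: lambda_stat_def u_weight_def)
  show "(\<lambda>\<omega>. kappa1 m s n (\<lambda>i. card (D i \<omega>))) \<in> borel_measurable M"
    using assms by (intro measurable_fun_D[of "\<lambda>S. kappa1 m s n (\<lambda>i. card (S i))"])
      (simp add: kappa1_def u_weight_def)
  show "(\<lambda>\<omega>. kappa2 m s n (\<lambda>i. card (D i \<omega>))) \<in> borel_measurable M"
    using assms by (intro measurable_fun_D[of "\<lambda>S. kappa2 m s n (\<lambda>i. card (S i))"])
      (simp add: kappa2_def u_weight_def)
qed

text \<open>The degree counts indicators, so its event is a Poisson binomial mass with entries 0 or
  1. For a fixed value of \<open>D 1\<close> these entries have the same means as the tails, by
  \<open>expectation_overlap\<close>, and may be exchanged for them inside the expectation.\<close>

lemma prob_degree_eq: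
  assumes n: "1 \<le> n"
  shows "prob {\<omega> \<in> space M. graph_degree (intersection_graph s n (\<lambda>i. D i \<omega>)) 1 = k}
    = expectation (\<lambda>\<omega>. poisson_binomial {2..n} (\<lambda>i. overlap_prob W s (D 1 \<omega>) (card (D i \<omega>))) k)"
proof -
  let ?E = "{\<omega> \<in> space M. graph_degree (intersection_graph s n (\<lambda>i. D i \<omega>)) 1 = k}"
  have "?E \<inter> space M = ?E" by auto
  then have "prob ?E = expectation (indicator ?E)" by simp
  also have "\<dots> = expectation (\<lambda>\<omega>. poisson_binomial {2..n} (\<lambda>i. of_bool (s \<le> card (D 1 \<omega> \<inter> D i \<omega>))) k)"
    unfolding poisson_binomial_indicator[OF finite_atLeastAtMost] graph_degree_intersection_graph[OF n]
    by (intro Bochner_Integration.integral_cong refl) (simp add: indicator_def)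
  also have "\<dots> = expectation (\<lambda>\<omega>. poisson_binomial {2..n} (\<lambda>i. overlap_prob W s (D 1 \<omega>) (card (D i \<omega>))) k)"
    using n by (intro expectation_poisson_binomial_cong expectation_overlap) auto
  finally show ?thesis .
qed

text \<open>Off the two exceptional events the pointwise error is at most
  \<open>2 * \<epsilon> + \<epsilon>\<close>, where \<open>\<epsilon> < 1\<close> secures
  \<open>kappa1 < 1\<close>. On them both masses lie in [0, 1], so the error is at most 1.\<close>

lemma prob_degree_approx:
  fixes \<epsilon> :: real
  assumes n: "1 \<le> n" and \<epsilon>: "0 < \<epsilon>" "\<epsilon> < 1"
  shows "\<bar>prob {\<omega> \<in> space M. graph_degree (intersection_graph s n (\<lambda>i. D i \<omega>)) 1 = k}
      - expectation (\<lambda>\<omega>. pois k (lambda_stat (card W) s n (\<lambda>i. card (D i \<omega>))))\<bar>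
    \<le> 3 * \<epsilon> + prob {\<omega> \<in> space M. \<epsilon> < \<bar>kappa1 (card W) s n (\<lambda>i. card (D i \<omega>))\<bar>}
        + prob {\<omega> \<in> space M. \<epsilon> < \<bar>kappa2 (card W) s n (\<lambda>i. card (D i \<omega>))\<bar>}"
proof -
  define L where "L \<omega> = pois k (lambda_stat (card W) s n (\<lambda>i. card (D i \<omega>)))" for \<omega>
  define Q where "Q \<omega> = poisson_binomial {2..n} (\<lambda>i. overlap_prob W s (D 1 \<omega>) (card (D i \<omega>))) k" for \<omega>
  define k1 where "k1 \<omega> = kappa1 (card W) s n (\<lambda>i. card (D i \<omega>))" for \<omega>
  define k2 where "k2 \<omega> = kappa2 (card W) s n (\<lambda>i. card (D i \<omega>))" for \<omega>
  define E1 where "E1 = {\<omega> \<in> space M. \<epsilon> < \<bar>k1 \<omega>\<bar>}"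
  define E2 where "E2 = {\<omega> \<in> space M. \<epsilon> < \<bar>k2 \<omega>\<bar>}"
  have [measurable]: "k1 \<in> borel_measurable M" "k2 \<in> borel_measurable M"
    unfolding k1_def k2_def using measurable_kappa1[OF n] measurable_kappa2[OF n] by auto
  have E [measurable]: "E1 \<in> events" "E2 \<in> events" unfolding E1_def E2_def by measurable
  have L: "integrable M L" unfolding L_def
    using n by (intro integrable_fun_D[of "\<lambda>S. pois k (lambda_stat (card W) s n (\<lambda>i. card (S i)))"])
      (simp add: lambda_stat_def u_weight_def)
  have Q: "integrable M Q" unfolding Q_def
  proof (rule integrable_fun_D[of "\<lambda>S. poisson_binomial {2..n} (\<lambda>i. overlap_prob W s (S 1) (card (S i))) k"])
    fix S T :: "nat \<Rightarrow> 'w set" assume "\<And>i. i \<in> {1..n} \<Longrightarrow> S i = T i"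
    then show "poisson_binomial {2..n} (\<lambda>i. overlap_prob W s (S 1) (card (S i))) k
        = poisson_binomial {2..n} (\<lambda>i. overlap_prob W s (T 1) (card (T i))) k"
      using n unfolding poisson_binomial_def by (intro sum.cong arg_cong2[where f = "(*)"] prod.cong) auto
  qed
  have bound: "\<bar>Q \<omega> - L \<omega>\<bar> \<le> 3 * \<epsilon> + indicator E1 \<omega> + indicator E2 \<omega>" if w: "\<omega> \<in> space M" for \<omega>
  proof (cases "\<omega> \<in> E1 \<union> E2")
    case True
    have "0 \<le> Q \<omega> \<and> Q \<omega> \<le> 1"
      unfolding Q_def by (intro poisson_binomial_bounds conjI overlap_prob_bounds finite_W) auto
    moreover have "0 \<le> L \<omega>" "L \<omega> \<le> 1"
      unfolding L_def by (auto intro: pois_nonneg pois_le_1 lambda_stat_nonneg)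
    ultimately have "\<bar>Q \<omega> - L \<omega>\<bar> \<le> 1" by linarith
    also have "\<dots> \<le> 3 * \<epsilon> + indicator E1 \<omega> + indicator E2 \<omega>"
      using True \<epsilon> by (auto simp: indicator_def)
    finally show ?thesis .
  next
    case False
    then have "\<bar>k1 \<omega>\<bar> \<le> \<epsilon>" "\<bar>k2 \<omega>\<bar> \<le> \<epsilon>" using w by (auto simp: E1_def E2_def)
    moreover from this have "\<bar>Q \<omega> - L \<omega>\<bar> \<le> 2 * k1 \<omega> + k2 \<omega>"
      unfolding Q_def L_def k1_def k2_def using \<epsilon> D_subset w n
      by (intro poisson_binomial_overlap_approx finite_W) auto
    ultimately show ?thesis using False by simp
  qed
  have "\<bar>expectation Q - expectation L\<bar> = \<bar>expectation (\<lambda>\<omega>. Q \<omega> - L \<omega>)\<bar>"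
    using L Q by simp
  also have "\<dots> \<le> expectation (\<lambda>\<omega>. \<bar>Q \<omega> - L \<omega>\<bar>)"
    by (rule integral_abs_bound)
  also have "\<dots> \<le> expectation (\<lambda>\<omega>. 3 * \<epsilon> + indicator E1 \<omega> + indicator E2 \<omega>)"
    using L Q bound E by (intro integral_mono) (auto simp: less_top [symmetric])
  also have "\<dots> = 3 * \<epsilon> + prob E1 + prob E2"
    using E by (simp add: prob_space less_top [symmetric])
  finally show ?thesis
    unfolding prob_degree_eq[OF n] Q_def L_def E1_def E2_def k1_def k2_def .
qed

end

section \<open>Passage to the limit\<close>

theorem theorem2p2:
  fixes M :: "nat \<Rightarrow> 'a measure"
    and W :: "nat \<Rightarrow> 'w set"
    and n s :: "nat \<Rightarrow> nat"
    and D :: "nat \<Rightarrow> nat \<Rightarrow> 'a \<Rightarrow> 'w set"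
    and X :: "nat \<Rightarrow> 'a \<Rightarrow> nat \<Rightarrow> nat"
    and N :: "'b measure"
    and \<Lambda> :: "'b \<Rightarrow> real"
    and k :: nat
  assumes subsets: "\<And>m. uniform_random_subsets (M m) (W m) (n m) (D m)"
    and card_W: "\<And>m. card (W m) = m"
    and s_ge_1: "\<And>m. s m \<ge> 1"
    and n_at_top: "filterlim n at_top sequentially"
    and X_def: "\<And>m \<omega> i. X m \<omega> i = card (D m i \<omega>)"
    and N_prob: "prob_space N"
    and \<Lambda>_rv: "\<Lambda> \<in> borel_measurable N"
    and iv: "tendsto_in_distribution M (\<lambda>m \<omega>. lambda_stat m (s m) (n m) (X m \<omega>)) N \<Lambda>"
    and v: "tendsto_in_probability M (\<lambda>m \<omega>. kappa1 m (s m) (n m) (X m \<omega>)) 0"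
    and vi: "tendsto_in_probability M (\<lambda>m \<omega>. kappa2 m (s m) (n m) (X m \<omega>)) 0"
  shows "(\<lambda>m. measure (M m) {\<omega> \<in> space (M m).
            graph_degree (intersection_graph (s m) (n m) (\<lambda>i. D m i \<omega>)) 1 = k})
         \<longlonglongrightarrow> 1 / fact k * (LINT \<omega>|N. \<Lambda> \<omega> ^ k * exp (- \<Lambda> \<omega>))"
proof -
  have X: "X m \<omega> = (\<lambda>i. card (D m i \<omega>))" for m \<omega> using X_def by auto
  define lam where "lam m \<omega> = lambda_stat m (s m) (n m) (X m \<omega>)" for m \<omega>
  define p where "p m = measure (M m) {\<omega> \<in> space (M m).
    graph_degree (intersection_graph (s m) (n m) (\<lambda>i. D m i \<omega>)) 1 = k}" for m
  define K1 where "K1 \<epsilon> m = measure (M m) {\<omega> \<in> space (M m). \<bar>kappa1 m (s m) (n m) (X m \<omega>) - 0\<bar> > \<epsilon>}" for \<epsilon> m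
  define K2 where "K2 \<epsilon> m = measure (M m) {\<omega> \<in> space (M m). \<bar>kappa2 m (s m) (n m) (X m \<omega>) - 0\<bar> > \<epsilon>}" for \<epsilon> m
  interpret U: uniform_random_subsets "M m" "W m" "n m" "D m" for m by (rule subsets)
  interpret N: prob_space N by (rule N_prob)
  have lam0: "0 \<le> lam m \<omega>" for m \<omega> by (simp add: lam_def lambda_stat_nonneg)
  have lam_rv: "lam m \<in> borel_measurable (M m)" for m
  proof (cases "1 \<le> n m")
    case True
    then show ?thesis unfolding lam_def X by (rule U.measurable_lambda_stat)
  next
    \<comment> \<open>Weak convergence calls for measurability at every \<open>m\<close>; for
      \<open>n m = 0\<close> the sum is empty and the statistic is constant.\<close>
    case False
    then have "{2..n m} = {}" by auto
    then show ?thesis by (simp add: lam_def [abs_def] lambda_stat_def)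
  qed
  have n1: "\<forall>\<^sub>F m in sequentially. 1 \<le> n m"
    using n_at_top by (simp add: filterlim_at_top)
  have diff: "(\<lambda>m. p m - (LINT \<omega>|M m. pois k (lam m \<omega>))) \<longlonglongrightarrow> 0"
  proof (rule tendstoI)
    fix e :: real assume "0 < e"
    \<comment> \<open>The bound 1/2 keeps \<open>\<epsilon> < 1\<close>. The total error stays below
      \<open>3 * \<epsilon> + \<epsilon> + \<epsilon>\<close>, which is less than
      \<open>6 * \<epsilon> \<le> e\<close>.\<close>
    define \<epsilon> where "\<epsilon> = min (1/2) (e / 6)"
    have \<epsilon>: "0 < \<epsilon>" "\<epsilon> < 1" "6 * \<epsilon> \<le> e" using \<open>0 < e\<close> by (auto simp: \<epsilon>_def min_def)
    have "K1 \<epsilon> \<longlonglongrightarrow> 0" "K2 \<epsilon> \<longlonglongrightarrow> 0"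
      using v vi \<epsilon>(1) unfolding tendsto_in_probability_def K1_def K2_def by auto
    then have "\<forall>\<^sub>F m in sequentially. K1 \<epsilon> m < \<epsilon>" "\<forall>\<^sub>F m in sequentially. K2 \<epsilon> m < \<epsilon>"
      using \<epsilon>(1) by (auto intro: order_tendstoD)
    with n1 show "\<forall>\<^sub>F m in sequentially. dist (p m - (LINT \<omega>|M m. pois k (lam m \<omega>))) 0 < e"
    proof eventually_elim
      case (elim m)
      have "\<bar>p m - (LINT \<omega>|M m. pois k (lam m \<omega>))\<bar> \<le> 3 * \<epsilon> + K1 \<epsilon> m + K2 \<epsilon> m"
        using U.prob_degree_approx[OF elim(1) \<epsilon>(1,2), of "s m" k]
        unfolding p_def lam_def K1_def K2_def X card_W by simp
      with elim \<epsilon> show ?case by (simp add: dist_real_def)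
    qed
  qed
  have conv: "(\<lambda>m. LINT \<omega>|M m. f (lam m \<omega>)) \<longlonglongrightarrow> (LINT \<omega>|N. f (\<Lambda> \<omega>))"
    if f: "\<And>x. isCont f x" "\<And>x. norm (f x) \<le> B" for f :: "real \<Rightarrow> real" and B
  proof -
    have [measurable]: "f \<in> borel_measurable borel"
      using f(1) by (intro borel_measurable_continuous_onI continuous_at_imp_continuous_on) auto
    have "(\<lambda>m. integral\<^sup>L (distr (M m) borel (lam m)) f) \<longlonglongrightarrow> integral\<^sup>L (distr N borel \<Lambda>) f"
      using iv f lam_rv \<Lambda>_rv unfolding tendsto_in_distribution_def lam_def[symmetric]
      by (intro weak_conv_imp_integral_bdd_continuous_conv U.real_distribution_distr
          N.real_distribution_distr) auto
    then show ?thesis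
      using lam_rv \<Lambda>_rv by (simp add: integral_distr)
  qed
  \<comment> \<open>The limit inherits nonnegativity: \<open>g\<close> is bounded and continuous,
    zero on the nonnegative axis and positive elsewhere, and its expectation under \<Lambda> is a
    limit of zeros.\<close>
  have nonneg: "AE \<omega> in N. 0 \<le> \<Lambda> \<omega>"
  proof -
    define g :: "real \<Rightarrow> real" where "g x = min 1 (max 0 (- x))" for x
    have g: "isCont g x" "norm (g x) \<le> 1" for x
      unfolding g_def [abs_def] by (auto intro!: continuous_intros)
    have "g (lam m \<omega>) = 0" for m \<omega>
      using lam0[of m \<omega>] by (simp add: g_def)
    then have "(LINT \<omega>|N. g (\<Lambda> \<omega>)) = 0"
      using conv[of g 1, OF g] by (simp add: LIMSEQ_const_iff)
    moreover have "integrable N (\<lambda>\<omega>. g (\<Lambda> \<omega>))"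
      using \<Lambda>_rv g(2) by (intro N.integrable_const_bound[of _ 1]) (auto simp: g_def)
    ultimately have "AE \<omega> in N. g (\<Lambda> \<omega>) = 0"
      by (subst (asm) integral_nonneg_eq_0_iff_AE) (auto simp: g_def)
    then show ?thesis
      by eventually_elim (auto simp: g_def min_def max_def split: if_splits)
  qed
  \<comment> \<open>\<open>pois k\<close> is unbounded on the negative axis. Composition with
    \<open>max 0\<close> yields a bounded continuous test function and changes nothing at
    \<open>lam\<close>, nor at \<Lambda> almost surely.\<close>
  have "(\<lambda>m. LINT \<omega>|M m. pois k (max 0 (lam m \<omega>))) \<longlonglongrightarrow> (LINT \<omega>|N. pois k (max 0 (\<Lambda> \<omega>)))"
  proof (rule conv)
    show "isCont (\<lambda>x. pois k (max 0 x)) x" for x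
      by (intro isCont_o2[OF _ isCont_pois] continuous_intros)
    show "norm (pois k (max 0 x)) \<le> 1" for x
      using pois_nonneg[of "max 0 x" k] pois_le_1[of "max 0 x" k] by simp
  qed
  moreover have "(LINT \<omega>|N. pois k (max 0 (\<Lambda> \<omega>))) = (LINT \<omega>|N. 1 / fact k * (\<Lambda> \<omega> ^ k * exp (- \<Lambda> \<omega>)))"
    using nonneg \<Lambda>_rv unfolding pois_def
    by (intro integral_cong_AE) (auto elim!: eventually_mono)
  ultimately have "(\<lambda>m. LINT \<omega>|M m. pois k (lam m \<omega>))
      \<longlonglongrightarrow> 1 / fact k * (LINT \<omega>|N. \<Lambda> \<omega> ^ k * exp (- \<Lambda> \<omega>))"
    using lam0 by (simp add: max_def)
  from tendsto_add[OF diff this] show ?thesis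
    by (simp add: p_def)
qed

end
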